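(* Let $(\varphi_n)_{n\ge1}$ be an orthonormal system on $[0,1]$. If for some $t\in G$ $$\limsup_{n\to\infty}M_n(t)=+\infty,$$ then there exists a function $r\in C_L$ such that $$\limsup_{n\to\infty}|S_n(t,r)|=+\infty.$$
   Context: An orthonormal system (ONS) $(\varphi_n)_{n\ge1}$ on $[0,1]$ is a sequence of real-valued functions, defined (with finite values) at every point of $[0,1]$, which is orthonormal in $L_2=L_2([0,1])$ with respect to Lebesgue measure. $Lip1$ is the class of continuous functions $f$ on $[0,1]$ that are Lipschitz, i.e. $|f(x)-f(y)|=O(h)$ whenever $|x-y|\le h$. $C_L$ is the class of differentiable functions $f$ on $[0,1]$ with $f'\in Lip1$. For $f\in L_2$: $C_n(f)=\int_0^1 f(u)\varphi_n(u)\,du$ and $S_n(x,f)=\sum_{k=1}^n C_k(f)\varphi_k(x)$. Put $g_k(u)=\int_0^u\varphi_k(v)\,dv$, $Q_n(u,x)=\sum_{k=1}^n g_k(u)\varphi_k(x)$ and $$M_n(x)=\frac1n\sum_{i=1}^{n-1}\left|\int_0^{i/n}Q_n(u,x)\,du\right|.$$ $G=[0,1]\setminus F$, where $F=\{x\in[0,1]:\limsup_{n\to\infty}\frac1{n^2}\sum_{k=1}^n\varphi_k^2(x)=\infty\}$. *)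

theory Defs
  imports "HOL-Analysis.Analysis"
begin

text \<open>
  Functions on $[0,1]$ are total functions on the reals; only their values on \<open>{0..1}\<close> matter.
  Sequences are indexed by \<open>n \<ge> 1\<close>; the value at index \<open>0\<close> is never used.
\<close>

definition L2 :: "(real \<Rightarrow> real) set" where
  "L2 = {f. set_borel_measurable lebesgue {0..1} f \<and>
            set_integrable lebesgue {0..1} (\<lambda>x. (f x)\<^sup>2)}"

definition orthonormal_system :: "(nat \<Rightarrow> real \<Rightarrow> real) \<Rightarrow> bool" where
  "orthonormal_system \<phi> \<longleftrightarrow>
     (\<forall>n\<ge>1. \<phi> n \<in> L2) \<and>
     (\<forall>m\<ge>1. \<forall>n\<ge>1. (LINT x:{0..1}|lebesgue. \<phi> m x * \<phi> n x) = (if m = n then 1 else 0))"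

definition Lip1 :: "(real \<Rightarrow> real) set" where
  "Lip1 = {f. \<exists>C. C-lipschitz_on {0..1} f}"

text \<open>Differentiability at the endpoints is one-sided.\<close>

definition C_L :: "(real \<Rightarrow> real) set" where
  "C_L = {f. \<exists>f'. (\<forall>x\<in>{0..1}. (f has_real_derivative f' x) (at x within {0..1})) \<and> f' \<in> Lip1}"

definition fourier_coeff :: "(nat \<Rightarrow> real \<Rightarrow> real) \<Rightarrow> nat \<Rightarrow> (real \<Rightarrow> real) \<Rightarrow> real" where
  "fourier_coeff \<phi> n f = (LINT u:{0..1}|lebesgue. f u * \<phi> n u)"

definition fourier_sum :: "(nat \<Rightarrow> real \<Rightarrow> real) \<Rightarrow> nat \<Rightarrow> real \<Rightarrow> (real \<Rightarrow> real) \<Rightarrow> real" where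
  "fourier_sum \<phi> n x f = (\<Sum>k=1..n. fourier_coeff \<phi> k f * \<phi> k x)"

definition g :: "(nat \<Rightarrow> real \<Rightarrow> real) \<Rightarrow> nat \<Rightarrow> real \<Rightarrow> real" where
  "g \<phi> k u = (LINT v:{0..u}|lebesgue. \<phi> k v)"

definition Q :: "(nat \<Rightarrow> real \<Rightarrow> real) \<Rightarrow> nat \<Rightarrow> real \<Rightarrow> real \<Rightarrow> real" where
  "Q \<phi> n u x = (\<Sum>k=1..n. g \<phi> k u * \<phi> k x)"

definition M :: "(nat \<Rightarrow> real \<Rightarrow> real) \<Rightarrow> nat \<Rightarrow> real \<Rightarrow> real" where
  "M \<phi> n x =
     1 / real n * (\<Sum>i=1..<n. \<bar>LINT u:{0..real i / real n}|lebesgue. Q \<phi> n u x\<bar>)"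

definition F :: "(nat \<Rightarrow> real \<Rightarrow> real) \<Rightarrow> real set" where
  "F \<phi> = {x\<in>{0..1}.
     limsup (\<lambda>n. ereal (1 / (real n)\<^sup>2 * (\<Sum>k=1..n. (\<phi> k x)\<^sup>2))) = \<infinity>}"

definition G :: "(nat \<Rightarrow> real \<Rightarrow> real) \<Rightarrow> real set" where
  "G \<phi> = {0..1} - F \<phi>"

end

theory Submission
  imports Defs
begin

text \<open>
  Fix \<open>t\<close> and let \<open>K\<^sub>n u\<close> be the kernel of the \<open>n\<close>-th partial sum at \<open>t\<close>, that is, the sum of
  \<open>\<phi> k u * \<phi> k t\<close> over \<open>k \<le> n\<close>. Its first antiderivative from \<open>0\<close> is \<open>Q \<phi> n u t\<close>; let
  \<open>W\<^sub>n\<close> be the second one.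

  For continuous \<open>h\<close> let \<open>r u\<close> be the double integral of \<open>h\<close> from the right endpoint; it lies in \<open>C_L\<close>
  and \<open>r'' = h\<close>. Since \<open>r\<close> and \<open>r'\<close> vanish at \<open>1\<close> and \<open>Q\<close> and \<open>W\<^sub>n\<close> vanish at \<open>0\<close>, integrating by parts twice
  (as Fubini on a triangle, because \<open>K\<^sub>n\<close> is only square integrable) turns the \<open>n\<close>-th partial sum of
  \<open>r\<close> at \<open>t\<close> into the integral of \<open>h * W\<^sub>n\<close>: see \<open>fourier_sum_iterated_antiderivative\<close>.

  Suppose that for every \<open>r\<close> in \<open>C_L\<close> the partial sums at \<open>t\<close> stay bounded. Then the functionals that map
  \<open>h\<close> to the integral of \<open>h * W\<^sub>n\<close> are pointwise bounded on the continuous functions, so by the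
  Banach--Steinhaus theorem the \<open>L\<close>\<open>\<^sup>1\<close> norms of the \<open>W\<^sub>n\<close> are bounded: see
  \<open>L1_bounded_if_weakly_bounded\<close>.

  Finally \<open>M \<phi> n t\<close> is a Riemann sum for the \<open>L\<close>\<open>\<^sup>1\<close> norm of \<open>W\<^sub>n\<close>. As \<open>t\<close> lies in \<open>G\<close>, the \<open>L\<close>\<open>\<^sup>2\<close> norm of \<open>K\<^sub>n\<close> is
  \<open>O(n)\<close>, hence \<open>Q\<close> is \<open>O(n)\<close> uniformly, and the Riemann sum with step \<open>1/n\<close> exceeds the \<open>L\<close>\<open>\<^sup>1\<close>
  norm of \<open>W\<^sub>n\<close> by at most a bounded amount: see \<open>M_le_L1_norm\<close>. So \<open>M \<phi> n t\<close> would be bounded in \<open>n\<close>.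
\<close>

section \<open>Unbounded real sequences\<close>

lemma limsup_ereal_eq_infinity_iff:
  fixes x :: "nat \<Rightarrow> real"
  shows "limsup (\<lambda>n. ereal (x n)) = \<infinity> \<longleftrightarrow> \<not> bdd_above (range x)"
proof
  assume L: "limsup (\<lambda>n. ereal (x n)) = \<infinity>"
  show "\<not> bdd_above (range x)"
  proof
    assume "bdd_above (range x)"
    then obtain B where "\<And>n. x n \<le> B"
      by (auto simp: bdd_above_def)
    then have "limsup (\<lambda>n. ereal (x n)) \<le> ereal B"
      by (intro Limsup_bounded) auto
    with L show False by simp
  qed
next
  assume unb: "\<not> bdd_above (range x)"
  show "limsup (\<lambda>n. ereal (x n)) = \<infinity>"
  proof (rule ccontr)
    assume "limsup (\<lambda>n. ereal (x n)) \<noteq> \<infinity>"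
    then have "limsup (\<lambda>n. ereal (x n)) < \<infinity>"
      by (simp add: less_top[symmetric])
    then obtain B where "limsup (\<lambda>n. ereal (x n)) < ereal B"
      using ereal_dense2 by blast
    then have "eventually (\<lambda>n. ereal (x n) < ereal B) sequentially"
      by (rule Limsup_lessD)
    then obtain N where N: "\<And>n. n \<ge> N \<Longrightarrow> x n < B"
      by (auto simp: eventually_sequentially)
    have "x n \<le> max B (Max (x ` {..N}))" for n
      using N[of n] by (cases "n \<le> N") (auto simp: le_max_iff_disj)
    with unb show False
      by (auto simp: bdd_above_def)
  qed
qed

section \<open>Uniform boundedness\<close>

text \<open>
  Why one of the two points \<open>x \<plusminus> w\<close> works: the values of \<open>T\<close> there differ by \<open>2 T w\<close>, so they
  cannot both be small. Hence moving a point by \<open>r\<close> produces a value of order \<open>r * onorm T\<close>,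
  whatever the starting point is. The factor \<open>2/3\<close> absorbs that the operator norm need not be
  attained.
\<close>
lemma bounded_linear_large_value_near:
  fixes T :: "'a::real_normed_vector \<Rightarrow> 'b::real_normed_vector"
  assumes T: "bounded_linear T" and r: "r > 0"
  obtains y where "norm (y - x) \<le> r" "norm (T y) \<ge> 2/3 * r * onorm T"
proof (cases "onorm T = 0")
  case True
  then show ?thesis
    using r by (intro that[of x]) auto
next
  case False
  interpret T: bounded_linear T by fact
  from False have pos: "onorm T > 0"
    using onorm_pos_le[OF T] by simp
  have "\<exists>z. norm (T z) > 2/3 * onorm T * norm z"
  proof (rule ccontr)
    assume "\<not> ?thesis"
    then have "onorm T \<le> 2/3 * onorm T"
      using pos by (intro onorm_bound) (auto simp: not_less)
    with pos show False by simp
  qed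
  then obtain z where z: "norm (T z) > 2/3 * onorm T * norm z" ..
  then have z0: "norm z > 0"
    by (cases "z = 0") (auto simp: T.zero)
  define w where "w = (r / norm z) *\<^sub>R z"
  have nw: "norm w = r"
    using z0 r by (simp add: w_def)
  have "2/3 * r * onorm T = r / norm z * (2/3 * onorm T * norm z)"
    using z0 by simp
  also have "\<dots> \<le> r / norm z * norm (T z)"
    using z r z0 by (intro mult_left_mono) auto
  also have "\<dots> = norm (T w)"
    using r z0 by (simp add: w_def T.scaleR)
  finally have Tw: "2/3 * r * onorm T \<le> norm (T w)" .
  have "2 * norm (T w) = norm (T (x + w) - T (x - w))"
    by (simp add: T.add T.diff flip: scaleR_2)
  also have "\<dots> \<le> norm (T (x + w)) + norm (T (x - w))"
    by (rule norm_triangle_ineq4)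
  finally have "norm (T w) \<le> norm (T (x + w)) \<or> norm (T w) \<le> norm (T (x - w))"
    by linarith
  then show ?thesis
    using Tw nw that[of "x + w"] that[of "x - w"] by auto
qed

text \<open>
  The Banach--Steinhaus theorem, by Sokal's gliding hump, which avoids Baire category. Along operators
  with norms above \<open>4 ^ n\<close>, move by at most \<open>(1/3) ^ n\<close> in step \<open>n\<close> to make the value of the \<open>n\<close>-th
  operator large. All later moves add up to at most \<open>(1/3) ^ n / 2\<close>, where \<open>1/2\<close> is less
  than the guaranteed fraction \<open>2/3\<close>, so the limit point still has values growing like \<open>(4/3) ^ n\<close>.

  Norm and completeness are two separate sort constraints so that the theorem applies to the
  bounded continuous functions \<open>real \<Rightarrow>\<^sub>C real\<close>.
\<close>
theorem uniform_boundedness: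
  fixes T :: "'i \<Rightarrow> 'a::{real_normed_vector, complete_space} \<Rightarrow> 'b::real_normed_vector"
  assumes T: "\<And>i. bounded_linear (T i)"
    and pointwise: "\<And>x. \<exists>B. \<forall>i. norm (T i x) \<le> B"
  shows "\<exists>B. \<forall>i. onorm (T i) \<le> B"
proof (rule ccontr)
  assume "\<not> ?thesis"
  then have "\<forall>n. \<exists>i. onorm (T i) > 4 ^ n"
    by (meson not_less)
  then obtain i where i: "\<And>n::nat. onorm (T (i n)) > 4 ^ n"
    by metis
  have "\<exists>x. \<forall>n. norm (T (i n) (x n)) \<ge> 2/3 * (1/3)^n * onorm (T (i n))
               \<and> norm (x (Suc n) - x n) \<le> (1/3) ^ Suc n"
  proof (rule dependent_nat_choice)
    show "\<exists>x. norm (T (i 0) x) \<ge> 2/3 * (1/3)^0 * onorm (T (i 0))"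
      by (rule bounded_linear_large_value_near[OF T, of 1]) auto
    show "\<exists>y. norm (T (i (Suc n)) y) \<ge> 2/3 * (1/3)^Suc n * onorm (T (i (Suc n)))
              \<and> norm (y - x) \<le> (1/3) ^ Suc n" for x n
      by (rule bounded_linear_large_value_near[OF T, of "(1/3) ^ Suc n"]) auto
  qed
  then obtain x where
    large: "\<And>n. norm (T (i n) (x n)) \<ge> 2/3 * (1/3)^n * onorm (T (i n))" and
    step: "\<And>n. norm (x (Suc n) - x n) \<le> (1/3) ^ Suc n"
    by blast
  have close: "norm (x m - x n) \<le> ((1/3)^n - (1/3)^m) / 2" if "n \<le> m" for m n
    using that
  proof (induction m rule: dec_induct)
    case (step m)
    have "norm (x (Suc m) - x n) \<le> norm (x (Suc m) - x m) + norm (x m - x n)"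
      using norm_triangle_ineq[of "x (Suc m) - x m" "x m - x n"] by simp
    with step.IH \<open>norm (x (Suc m) - x m) \<le> _\<close> show ?case by simp
  qed simp
  have close': "norm (x m - x n) \<le> (1/3)^n / 2" if "n \<le> m" for m n
    by (rule order_trans[OF close[OF that]]) simp
  have "Cauchy x"
  proof (rule CauchyI')
    fix e :: real assume "e > 0"
    then obtain N where N: "(1/3)^N < e"
      using real_arch_pow_inv[of e "1/3"] by auto
    have "dist (x m) (x n) < e" if "m \<ge> N" "m < n" for m n
    proof -
      have "dist (x m) (x n) \<le> (1/3)^m / 2"
        using close'[of m n] that by (simp add: dist_norm norm_minus_commute)
      also have "\<dots> < (1/3)^m" by simp
      also have "\<dots> \<le> (1/3)^N"
        using that by (intro power_decreasing) auto
      finally show ?thesis using N by simp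
    qed
    then show "\<exists>M. \<forall>m\<ge>M. \<forall>n>m. dist (x m) (x n) < e" by blast
  qed
  then obtain y where y: "x \<longlonglongrightarrow> y"
    using Cauchy_convergent convergent_def by blast
  have near: "norm (y - x n) \<le> (1/3)^n / 2" for n
  proof (rule Lim_bounded)
    show "(\<lambda>m. norm (x m - x n)) \<longlonglongrightarrow> norm (y - x n)"
      by (intro tendsto_intros y)
    show "\<forall>m\<ge>n. norm (x m - x n) \<le> (1/3)^n / 2"
      using close' by blast
  qed
  have grow: "norm (T (i n) y) \<ge> (4/3)^n / 6" for n
  proof -
    interpret bounded_linear "T (i n)" by (rule T)
    define p where "p = (1/3)^n * onorm (T (i n))"
    have "norm (T (i n) (y - x n)) \<le> onorm (T (i n)) * ((1/3)^n / 2)"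
      by (rule order_trans[OF onorm[OF T]]) (intro mult_left_mono near onorm_pos_le[OF T])
    then have "norm (T (i n) (y - x n)) \<le> p / 2"
      by (simp add: p_def mult.commute)
    moreover have "norm (T (i n) (x n)) \<le> norm (T (i n) y) + norm (T (i n) (y - x n))"
      using norm_triangle_ineq4[of "T (i n) y" "T (i n) (y - x n)"] by (simp add: diff)
    moreover have "norm (T (i n) (x n)) \<ge> 2/3 * p"
      using large[of n] by (simp only: p_def mult.assoc)
    ultimately have "norm (T (i n) y) \<ge> p / 6"
      by linarith
    moreover have "(1/3)^n * 4^n \<le> p"
      unfolding p_def using i[of n] by (intro mult_left_mono) auto
    moreover have "(4/3::real)^n = (1/3)^n * 4^n"
      by (simp flip: power_mult_distrib)
    ultimately show ?thesis by simp
  qed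
  obtain B where B: "\<And>j. norm (T j y) \<le> B"
    using pointwise by blast
  obtain n where "6 * B < (4/3)^n"
    using real_arch_pow[of "4/3" "6 * B"] by auto
  with grow[of n] B[of "i n"] show False by simp
qed

text \<open>
  The functions \<open>f n\<close> act on continuous functions by integration, and the norm of this functional is
  the \<open>L\<close>\<open>\<^sup>1\<close> norm of \<open>f n\<close>, so this is an instance of uniform boundedness. Testing
  against \<open>sgn (f n)\<close> would give the norm at once, but is not continuous; its smoothing
  \<open>f n / (\<bar>f n\<bar> + 1)\<close> loses at most the length of the interval.
\<close>
lemma L1_bounded_if_weakly_bounded:
  fixes f :: "nat \<Rightarrow> real \<Rightarrow> real"
  assumes cont: "\<And>n. continuous_on {a..b} (f n)"
    and weak: "\<And>h. continuous_on {a..b} h \<Longrightarrow> \<exists>B. \<forall>n. \<bar>integral {a..b} (\<lambda>x. h x * f n x)\<bar> \<le> B"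
  shows "\<exists>B. \<forall>n. integral {a..b} (\<lambda>x. \<bar>f n x\<bar>) \<le> B"
proof -
  define T :: "nat \<Rightarrow> (real \<Rightarrow>\<^sub>C real) \<Rightarrow> real"
    where "T n h = integral {a..b} (\<lambda>x. h x * f n x)" for n h
  have int: "(\<lambda>x. apply_bcontfun h x * f n x) integrable_on {a..b}" for h n
    by (intro integrable_continuous_real continuous_intros cont) auto
  have T: "bounded_linear (T n)" for n
  proof (rule bounded_linear_intro)
    show "T n (h + k) = T n h + T n k" for h k
      using int by (simp add: T_def distrib_right integral_add)
    show "T n (c *\<^sub>R h) = c *\<^sub>R T n h" for c h
      by (simp add: T_def mult.assoc)
    show "norm (T n h) \<le> norm h * integral {a..b} (\<lambda>x. \<bar>f n x\<bar>)" for h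
    proof -
      have "norm (T n h) \<le> integral {a..b} (\<lambda>x. norm h * \<bar>f n x\<bar>)"
        unfolding T_def
      proof (rule integral_norm_bound_integral)
        show "(\<lambda>x. norm h * \<bar>f n x\<bar>) integrable_on {a..b}"
          by (intro integrable_continuous_real continuous_intros cont)
        show "norm (h x * f n x) \<le> norm h * \<bar>f n x\<bar>" for x
          using norm_bounded[of h x] by (simp add: abs_mult mult_right_mono)
      qed (rule int)
      then show ?thesis by simp
    qed
  qed
  have "\<exists>B. \<forall>n. onorm (T n) \<le> B"
  proof (rule uniform_boundedness)
    show "bounded_linear (T n)" for n by (rule T)
    show "\<exists>B. \<forall>n. norm (T n h) \<le> B" for h
      using weak[of h] by (simp add: T_def)
  qed
  then obtain B where B: "\<And>n. onorm (T n) \<le> B" by blast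
  have "integral {a..b} (\<lambda>x. \<bar>f n x\<bar>) \<le> integral {a..b} (\<lambda>x. 1) + B" for n
  proof -
    \<comment> \<open>a continuous substitute for the sign of \<open>f n\<close>\<close>
    define s where "s x = f n x / (\<bar>f n x\<bar> + 1)" for x
    have s1: "norm (s x) \<le> 1" for x
      by (simp add: s_def abs_div divide_le_eq)
    have "continuous_on (cbox a b) s"
      unfolding s_def using cont[of n] by (auto intro!: continuous_intros)
    then obtain h :: "real \<Rightarrow>\<^sub>C real" where
      h: "\<And>x. x \<in> cbox a b \<Longrightarrow> h x = s x" "\<And>x. h x = s (clamp a b x)"
      using continuous_on_cbox_bcontfunE[of a b s] by metis
    have "norm h \<le> 1"
      using s1 h(2) by (intro norm_bound) simp
    have "integral {a..b} (\<lambda>x. \<bar>f n x\<bar>) \<le> integral {a..b} (\<lambda>x. 1 + h x * f n x)"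
    proof (rule integral_le)
      show "\<bar>f n x\<bar> \<le> 1 + h x * f n x" if "x \<in> {a..b}" for x
      proof -
        have "h x * f n x = \<bar>f n x\<bar>\<^sup>2 / (\<bar>f n x\<bar> + 1)"
          using h(1)[of x] that by (simp add: s_def power2_eq_square)
        moreover have "\<bar>f n x\<bar> - 1 \<le> \<bar>f n x\<bar>\<^sup>2 / (\<bar>f n x\<bar> + 1)"
          by (subst pos_le_divide_eq) (auto simp: algebra_simps power2_eq_square)
        ultimately show ?thesis by simp
      qed
      show "(\<lambda>x. 1 + h x * f n x) integrable_on {a..b}"
        by (intro integrable_add int) auto
      show "(\<lambda>x. \<bar>f n x\<bar>) integrable_on {a..b}"
        by (intro integrable_continuous_real continuous_intros cont)
    qed
    also have "\<dots> = integral {a..b} (\<lambda>x. 1) + T n h"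
      unfolding T_def by (intro integral_add int) auto
    also have "T n h \<le> onorm (T n) * norm h"
      using onorm[OF T, of n h] by simp
    also have "\<dots> \<le> onorm (T n)"
      using \<open>norm h \<le> 1\<close> onorm_pos_le[OF T, of n] by (simp add: mult_left_le)
    also note B[of n]
    finally show ?thesis by simp
  qed
  then show ?thesis by blast
qed

section \<open>Riemann sums of Lipschitz functions\<close>

text \<open>
  On each cell of length \<open>1/n\<close> the function stays within \<open>L/n\<close> of its value at the right endpoint.
\<close>
lemma riemann_sum_le_integral:
  fixes f :: "real \<Rightarrow> real"
  assumes lip: "L-lipschitz_on {0..1} f" and pos: "\<And>x. x \<in> {0..1} \<Longrightarrow> f x \<ge> 0" and n: "n > 0"
  shows "1 / real n * (\<Sum>i=1..<n. f (real i / real n)) \<le> integral {0..1} f + L / n"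
proof -
  have cont: "continuous_on {0..1} f"
    by (rule lipschitz_on_continuous_on[OF lip])
  have int: "f integrable_on {c..d}" if "0 \<le> c" "d \<le> 1" for c d
    using that by (intro integrable_continuous_real continuous_on_subset[OF cont]) auto
  have "1 / n * (\<Sum>i=1..m. f (real i / real n)) \<le> integral {0..m / n} f + m * (L / n\<^sup>2)" if "m \<le> n" for m
    using that
  proof (induction m)
    case (Suc m)
    have le: "real m / n \<le> Suc m / n" "real (Suc m) / n \<le> 1" 
      using Suc.prems n by (auto simp: field_simps)
    have len: "Suc m / n - m / n = 1 / real n"
      by (simp add: add_divide_distrib)
    have "1 / n * f (Suc m / n) - L / n\<^sup>2 = (f (Suc m / n) - L / n) * (Suc m / n - m / n)"
      unfolding len by (simp add: diff_divide_distrib power2_eq_square)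
    also have "\<dots> = integral {m / n..Suc m / n} (\<lambda>x. f (Suc m / n) - L / n)"
      using le by simp
    also have "\<dots> \<le> integral {m / n..Suc m / n} f"
    proof (rule integral_le)
      fix x assume x: "x \<in> {m / n..Suc m / n}"
      then have x01: "x \<in> {0..1}"
        using le by (auto intro: order_trans[OF _ _ ] elim: order_trans[rotated])
      have "f (Suc m / n) - f x \<le> L * dist (Suc m / n) x"
        using lipschitz_onD(1)[OF lip _ x01, of "Suc m / n"] le by (auto simp: dist_real_def)
      also have "\<dots> \<le> L * (1 / n)"
        using x len lipschitz_on_nonneg[OF lip] by (intro mult_left_mono) (auto simp: dist_real_def)
      finally show "f (Suc m / n) - L / n \<le> f x" by simp
    qed (use le in \<open>auto intro: int\<close>)
    finally have "1 / n * f (Suc m / n) \<le> integral {m / n..Suc m / n} f + L / n\<^sup>2" by simp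
    moreover have "integral {0..m / n} f + integral {m / n..Suc m / n} f = integral {0..Suc m / n} f"
      using le by (intro Henstock_Kurzweil_Integration.integral_combine int) auto
    ultimately show ?case
      using Suc by (simp add: algebra_simps add_divide_distrib)
  qed simp
  from this[of n] have *: "1 / n * (\<Sum>i=1..n. f (real i / real n)) \<le> integral {0..1} f + L / n"
    using n by (simp add: power2_eq_square)
  \<comment> \<open>The sum in question omits the right endpoint \<open>i = n\<close>, whose term is nonnegative.\<close>
  have "(\<Sum>i=1..<n. f (real i / real n)) \<le> (\<Sum>i=1..n. f (real i / real n))"
    using n by (intro sum_mono2 pos) auto
  then have "1 / real n * (\<Sum>i=1..<n. f (real i / real n)) \<le> 1 / n * (\<Sum>i=1..n. f (real i / real n))"
    by (intro mult_left_mono) auto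
  with * show ?thesis by linarith
qed

section \<open>Integration by parts\<close>
lemma sigma_finite_lebesgue: "sigma_finite_measure (lebesgue :: 'a::euclidean_space measure)"
proof
  obtain A :: "'a set set" where A: "countable A" "A \<subseteq> sets lborel" "\<Union>A = space lborel"
    "\<forall>a\<in>A. emeasure lborel a \<noteq> \<infinity>"
    using lborel.sigma_finite_countable by blast
  then show "\<exists>A. countable A \<and> A \<subseteq> sets lebesgue \<and> \<Union>A = space lebesgue \<and>
      (\<forall>a\<in>A. emeasure (lebesgue :: 'a measure) a \<noteq> \<infinity>)"
    by (intro exI[of _ A]) (auto simp: subset_eq main_part_sets)
qed

text \<open>
  Both sides are the integral of \<open>a v * b u\<close> over the triangle \<open>u \<le> v\<close>. This is integration by parts
  for factors that are merely integrable; taking the tail integral of \<open>a\<close> and the initial integral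
  of \<open>b\<close> leaves no boundary terms.
\<close>
lemma integral_upper_tail_mult:
  fixes a b :: "real \<Rightarrow> real"
  assumes a: "a absolutely_integrable_on {c..d}" and b: "b absolutely_integrable_on {c..d}"
  shows "(LINT u:{c..d}|lebesgue. (LINT v:{u..d}|lebesgue. a v) * b u) =
         (LINT v:{c..d}|lebesgue. a v * (LINT u:{c..v}|lebesgue. b u))"
proof -
  interpret sigma_finite_measure "lebesgue :: real measure" by (rule sigma_finite_lebesgue)
  interpret pair_sigma_finite "lebesgue :: real measure" "lebesgue :: real measure" ..
  define a' where "a' x = indicator {c..d} x * a x" for x
  define b' where "b' x = indicator {c..d} x * b x" for x
  have a': "integrable lebesgue a'" and b': "integrable lebesgue b'"
    using a b by (simp_all add: set_integrable_def a'_def[abs_def] b'_def[abs_def])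
  have [measurable]: "a' \<in> borel_measurable lebesgue" "b' \<in> borel_measurable lebesgue"
    using a' b' by auto
  have [measurable]: "(\<lambda>x. x) \<in> borel_measurable (lebesgue :: real measure)"
    by (simp add: measurable_completion)
  have tri: "{p. fst p \<le> snd p} \<in> sets ((lebesgue :: real measure) \<Otimes>\<^sub>M (lebesgue :: real measure))"
  proof -
    have "{p \<in> space ((lebesgue :: real measure) \<Otimes>\<^sub>M (lebesgue :: real measure)). fst p \<le> snd p}
        \<in> sets ((lebesgue :: real measure) \<Otimes>\<^sub>M (lebesgue :: real measure))"
      by (rule borel_measurable_le)
        (auto intro: measurable_compose[OF measurable_fst] measurable_compose[OF measurable_snd]
           simp: measurable_completion)
    then show ?thesis by (simp add: space_pair_measure)
  qed
  have "integrable (lebesgue \<Otimes>\<^sub>M lebesgue) (\<lambda>(u, v). b' u * a' v)"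
  proof (rule Fubini_integrable)
    show "integrable lebesgue (\<lambda>u. LINT v|lebesgue. norm ((\<lambda>(u, v). b' u * a' v) (u, v)))"
      using a' b' by (simp add: abs_mult)
    show "AE u in lebesgue. integrable lebesgue (\<lambda>v. (\<lambda>(u, v). b' u * a' v) (u, v))"
      using a' by simp
  qed simp
  from integrable_mult_indicator[OF tri this]
  have "integrable (lebesgue \<Otimes>\<^sub>M lebesgue) (\<lambda>(u, v). indicator {p. fst p \<le> snd p} (u, v) * (b' u * a' v))"
    by (simp add: case_prod_unfold)
  from Fubini_integral[OF this]
  have swap: "(LINT v|lebesgue. LINT u|lebesgue. indicator {p. fst p \<le> snd p} (u, v) * (b' u * a' v)) =
      (LINT u|lebesgue. LINT v|lebesgue. indicator {p. fst p \<le> snd p} (u, v) * (b' u * a' v))" .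
  have 1: "(LINT v|lebesgue. indicator {p. fst p \<le> snd p} (u, v) * (b' u * a' v)) =
      indicator {c..d} u *\<^sub>R ((LINT v:{u..d}|lebesgue. a v) * b u)" for u
  proof -
    have eq: "indicator {p. fst p \<le> snd p} (u, v) * (b' u * a' v) = b' u * (indicator {u..d} v *\<^sub>R a v)" for v
      by (auto simp: indicator_def a'_def b'_def)
    show ?thesis
      unfolding eq by (simp add: set_lebesgue_integral_def b'_def)
  qed
  have 2: "(LINT u|lebesgue. indicator {p. fst p \<le> snd p} (u, v) * (b' u * a' v)) =
      indicator {c..d} v *\<^sub>R (a v * (LINT u:{c..v}|lebesgue. b u))" for v
  proof -
    have eq: "indicator {p. fst p \<le> snd p} (u, v) * (b' u * a' v) = a' v * (indicator {c..v} u *\<^sub>R b u)" for u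
      by (auto simp: indicator_def a'_def b'_def)
    show ?thesis
      unfolding eq by (simp add: set_lebesgue_integral_def a'_def)
  qed
  show ?thesis
    using swap unfolding 1 2 set_lebesgue_integral_def by simp
qed

section \<open>Square integrable functions\<close>
lemma L2_mult_integrable:
  assumes "f \<in> L2" "h \<in> L2"
  shows "(\<lambda>x. f x * h x) absolutely_integrable_on {0..1}"
  unfolding set_integrable_def
proof (rule Bochner_Integration.integrable_bound)
  let ?i = "indicator {0..1} :: real \<Rightarrow> real"
  show "integrable lebesgue (\<lambda>x. ?i x *\<^sub>R (f x)\<^sup>2 + ?i x *\<^sub>R (h x)\<^sup>2)"
    using assms by (auto simp: L2_def set_integrable_def)
  have "(\<lambda>x. (?i x *\<^sub>R f x) * (?i x *\<^sub>R h x)) \<in> borel_measurable lebesgue"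
    using assms by (intro borel_measurable_times) (auto simp: L2_def set_borel_measurable_def)
  also have "(\<lambda>x. (?i x *\<^sub>R f x) * (?i x *\<^sub>R h x)) = (\<lambda>x. ?i x *\<^sub>R (f x * h x))"
    by (auto simp: indicator_def)
  finally show "(\<lambda>x. ?i x *\<^sub>R (f x * h x)) \<in> borel_measurable lebesgue" .
  have "\<bar>p * q\<bar> \<le> \<bar>p\<^sup>2 + q\<^sup>2\<bar>" for p q :: real
  proof -
    have "0 \<le> (\<bar>p\<bar> - \<bar>q\<bar>)\<^sup>2" by simp
    then have "2 * \<bar>p * q\<bar> \<le> p\<^sup>2 + q\<^sup>2"
      by (simp add: power2_diff abs_mult)
    then show ?thesis by simp
  qed
  then show "AE x in lebesgue. norm (?i x *\<^sub>R (f x * h x)) \<le> norm (?i x *\<^sub>R (f x)\<^sup>2 + ?i x *\<^sub>R (h x)\<^sup>2)"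
    by (auto simp: indicator_def)
qed

lemma continuous_imp_L2:
  assumes "continuous_on {0..1} f"
  shows "f \<in> L2"
proof -
  have "f absolutely_integrable_on {0..1}"
    using assms by (rule absolutely_integrable_continuous_real)
  moreover have "(\<lambda>x. (f x)\<^sup>2) absolutely_integrable_on {0..1}"
    using assms by (intro absolutely_integrable_continuous_real continuous_intros)
  ultimately show ?thesis
    by (auto simp: L2_def set_integrable_def set_borel_measurable_def)
qed

lemma L2_imp_absolutely_integrable:
  assumes "f \<in> L2"
  shows "f absolutely_integrable_on {0..1}"
  using L2_mult_integrable[OF assms continuous_imp_L2[of "\<lambda>_. 1"]] by simp

section \<open>Test functions with prescribed second derivative\<close>

text \<open>
  These functions have second derivative \<open>h\<close>. Integrating from the right makes the function
  and its derivative vanish at \<open>1\<close>, in accordance with the absence of boundary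
  terms in the integration by parts above.
\<close>
lemma iterated_antiderivative_in_C_L:
  assumes h: "continuous_on {0..1} h"
  shows "(\<lambda>u. integral {u..1} (\<lambda>v. integral {v..1} h)) \<in> C_L"
proof -
  have tail: "((\<lambda>u. integral {u..1} f) has_real_derivative - f x) (at x within {0..1})"
    if f: "continuous_on {0..1} f" and x: "x \<in> {0..1}" for f :: "real \<Rightarrow> real" and x
  proof (rule has_field_derivative_transform_within[OF _ zero_less_one])
    show "integral {0..1} f - integral {0..u} f = integral {u..1} f" if "u \<in> {0..1}" for u
      using Henstock_Kurzweil_Integration.integral_combine[of 0 u 1 f] that integrable_continuous_real[OF f] by simp
    show "((\<lambda>u. integral {0..1} f - integral {0..u} f) has_real_derivative - f x) (at x within {0..1})"
      by (auto intro!: derivative_eq_intros integral_has_real_derivative[OF f x])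
  qed (fact x)
  define P where "P v = integral {v..1} h" for v
  have P: "(P has_real_derivative - h x) (at x within {0..1})" if "x \<in> {0..1}" for x
    unfolding P_def using tail[OF h that] .
  then have contP: "continuous_on {0..1} P"
    unfolding continuous_on_eq_continuous_within using DERIV_continuous by blast
  obtain B where B: "\<And>x. x \<in> {0..1} \<Longrightarrow> norm (h x) \<le> B"
    using compact_imp_bounded[OF compact_continuous_image[OF h compact_Icc]]
    unfolding bounded_iff by blast
  have "B-lipschitz_on {0..1} (\<lambda>v. - P v)"
  proof (rule lipschitz_onI)
    show "0 \<le> B" using B[of 0] by (auto intro: order_trans[OF norm_ge_zero])
    show "dist (- P x) (- P y) \<le> B * dist x y" if "x \<in> {0..1}" "y \<in> {0..1}" for x y
      using field_differentiable_bound[of "{0..1}" P "\<lambda>x. - h x" B x y] P B that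
      by (simp add: dist_norm norm_minus_commute)
  qed
  then have "(\<lambda>v. - P v) \<in> Lip1"
    by (auto simp: Lip1_def)
  moreover have "\<forall>x\<in>{0..1}. ((\<lambda>u. integral {u..1} P) has_real_derivative - P x) (at x within {0..1})"
    using tail[OF contP] by blast
  ultimately show ?thesis
    unfolding C_L_def P_def by (intro CollectI exI[of _ "\<lambda>v. - integral {v..1} h"] conjI)
qed

section \<open>The kernel of the partial sums\<close>
definition partial_sum_kernel :: "(nat \<Rightarrow> real \<Rightarrow> real) \<Rightarrow> nat \<Rightarrow> real \<Rightarrow> real \<Rightarrow> real" where
  "partial_sum_kernel \<phi> n t u = (\<Sum>k=1..n. \<phi> k u * \<phi> k t)"

lemma set_lebesgue_integral_sum:
  fixes f :: "'i \<Rightarrow> 'a \<Rightarrow> 'b::{banach, second_countable_topology}"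
  assumes "\<And>i. i \<in> I \<Longrightarrow> set_integrable N A (f i)"
  shows "(LINT x:A|N. \<Sum>i\<in>I. f i x) = (\<Sum>i\<in>I. LINT x:A|N. f i x)"
  using assms by (simp add: set_lebesgue_integral_def set_integrable_def scaleR_sum_right)

lemma kernel_absolutely_integrable:
  assumes "orthonormal_system \<phi>"
  shows "partial_sum_kernel \<phi> n t absolutely_integrable_on {0..1}"
proof -
  have "(\<lambda>u. \<phi> k u * \<phi> k t) absolutely_integrable_on {0..1}" if "k \<in> {1..n}" for k
    using assms that by (intro set_integrable_mult_left L2_imp_absolutely_integrable)
      (auto simp: orthonormal_system_def)
  then show ?thesis
    unfolding partial_sum_kernel_def[abs_def] by (intro absolutely_integrable_sum) auto
qed

lemma fourier_sum_eq_integral_kernel: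
  assumes \<phi>: "orthonormal_system \<phi>" and r: "continuous_on {0..1} r"
  shows "fourier_sum \<phi> n t r = (LINT u:{0..1}|lebesgue. r u * partial_sum_kernel \<phi> n t u)"
proof -
  have int: "(\<lambda>u. r u * \<phi> k u) absolutely_integrable_on {0..1}" if "k \<in> {1..n}" for k
    using \<phi> that by (intro L2_mult_integrable continuous_imp_L2[OF r]) (auto simp: orthonormal_system_def)
  have "(LINT u:{0..1}|lebesgue. r u * partial_sum_kernel \<phi> n t u) =
      (LINT u:{0..1}|lebesgue. (\<Sum>k=1..n. r u * \<phi> k u * \<phi> k t))"
    by (simp add: partial_sum_kernel_def sum_distrib_left mult.assoc)
  also have "\<dots> = (\<Sum>k=1..n. LINT u:{0..1}|lebesgue. r u * \<phi> k u * \<phi> k t)"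
    using int by (intro set_lebesgue_integral_sum) auto
  also have "\<dots> = fourier_sum \<phi> n t r"
    by (simp add: fourier_sum_def fourier_coeff_def)
  finally show ?thesis by simp
qed

lemma Q_eq_integral_kernel:
  assumes \<phi>: "orthonormal_system \<phi>" and u: "u \<in> {0..1}"
  shows "Q \<phi> n u t = (LINT v:{0..u}|lebesgue. partial_sum_kernel \<phi> n t v)"
proof -
  have int: "set_integrable lebesgue {0..u} (\<phi> k)" if "k \<in> {1..n}" for k
    using \<phi> that u by (intro set_integrable_subset[OF L2_imp_absolutely_integrable])
      (auto simp: orthonormal_system_def)
  have "(LINT v:{0..u}|lebesgue. partial_sum_kernel \<phi> n t v) = (\<Sum>k=1..n. LINT v:{0..u}|lebesgue. \<phi> k v * \<phi> k t)"
    unfolding partial_sum_kernel_def using int by (intro set_lebesgue_integral_sum) auto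
  then show ?thesis
    by (simp add: Q_def g_def)
qed

lemma continuous_on_Q:
  assumes \<phi>: "orthonormal_system \<phi>"
  shows "continuous_on {0..1} (\<lambda>u. Q \<phi> n u t)"
proof -
  note K = kernel_absolutely_integrable[OF \<phi>, of n t]
  have "continuous_on {0..1} (\<lambda>u. integral {0..u} (partial_sum_kernel \<phi> n t))"
    by (rule indefinite_integral_continuous_1) (rule set_lebesgue_integral_eq_integral(1)[OF K])
  moreover have "Q \<phi> n u t = integral {0..u} (partial_sum_kernel \<phi> n t)" if "u \<in> {0..1}" for u
    using that Q_eq_integral_kernel[OF \<phi> that]
      set_lebesgue_integral_eq_integral(2)[OF set_integrable_subset[OF K, of "{0..u}"]] by simp
  ultimately show ?thesis
    by (subst continuous_on_cong[OF refl]) auto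
qed

lemma integral_kernel_squared:
  assumes \<phi>: "orthonormal_system \<phi>"
  shows "(LINT u:{0..1}|lebesgue. (partial_sum_kernel \<phi> n t u)\<^sup>2) = (\<Sum>k=1..n. (\<phi> k t)\<^sup>2)"
    and "(\<lambda>u. (partial_sum_kernel \<phi> n t u)\<^sup>2) absolutely_integrable_on {0..1}"
proof -
  have int: "(\<lambda>u. \<phi> j u * \<phi> k u * (\<phi> j t * \<phi> k t)) absolutely_integrable_on {0..1}"
    if "j \<in> {1..n}" "k \<in> {1..n}" for j k
    using \<phi> that by (intro set_integrable_mult_left L2_mult_integrable) (auto simp: orthonormal_system_def)
  have sq: "(\<lambda>u. (partial_sum_kernel \<phi> n t u)\<^sup>2) = (\<lambda>u. \<Sum>j=1..n. \<Sum>k=1..n. \<phi> j u * \<phi> k u * (\<phi> j t * \<phi> k t))"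
    by (simp add: partial_sum_kernel_def power2_eq_square sum_product mult_ac)
  show "(\<lambda>u. (partial_sum_kernel \<phi> n t u)\<^sup>2) absolutely_integrable_on {0..1}"
    unfolding sq by (intro absolutely_integrable_sum int) auto
  have "(LINT u:{0..1}|lebesgue. (partial_sum_kernel \<phi> n t u)\<^sup>2) =
      (\<Sum>j=1..n. LINT u:{0..1}|lebesgue. \<Sum>k=1..n. \<phi> j u * \<phi> k u * (\<phi> j t * \<phi> k t))"
    unfolding sq by (intro set_lebesgue_integral_sum absolutely_integrable_sum int) auto
  also have "\<dots> = (\<Sum>j=1..n. \<Sum>k=1..n. LINT u:{0..1}|lebesgue. \<phi> j u * \<phi> k u * (\<phi> j t * \<phi> k t))"
    by (intro sum.cong refl set_lebesgue_integral_sum int) auto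
  also have "\<dots> = (\<Sum>j=1..n. \<Sum>k=1..n. if j = k then \<phi> j t * \<phi> k t else 0)"
    using \<phi> by (intro sum.cong refl) (auto simp: orthonormal_system_def)
  also have "\<dots> = (\<Sum>k=1..n. (\<phi> k t)\<^sup>2)"
    by (simp add: power2_eq_square)
  finally show "(LINT u:{0..1}|lebesgue. (partial_sum_kernel \<phi> n t u)\<^sup>2) = (\<Sum>k=1..n. (\<phi> k t)\<^sup>2)" .
qed

text \<open>
  \<open>Q\<close> is an antiderivative of the kernel, so it is bounded by the \<open>L\<close>\<open>\<^sup>1\<close> norm of the kernel, hence by
  its \<open>L\<close>\<open>\<^sup>2\<close> norm, which orthonormality expresses through the values of the system at \<open>t\<close>. The step
  from \<open>L\<close>\<open>\<^sup>2\<close> to \<open>L\<close>\<open>\<^sup>1\<close> uses \<open>\<bar>K\<bar> \<le> c/2 + K\<^sup>2/(2c)\<close>, which is sharp for \<open>\<bar>K\<bar> = c\<close>, instead of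
  the Cauchy--Schwarz inequality.
\<close>
lemma abs_Q_le:
  assumes \<phi>: "orthonormal_system \<phi>" and c: "c > 0" "(\<Sum>k=1..n. (\<phi> k t)\<^sup>2) \<le> c\<^sup>2"
    and u: "u \<in> {0..1}"
  shows "\<bar>Q \<phi> n u t\<bar> \<le> c"
proof -
  let ?K = "partial_sum_kernel \<phi> n t"
  have K: "?K absolutely_integrable_on {0..1}" by (rule kernel_absolutely_integrable[OF \<phi>])
  have Ku: "?K absolutely_integrable_on {0..u}"
    using u by (intro set_integrable_subset[OF K]) auto
  have "\<bar>Q \<phi> n u t\<bar> = \<bar>integral {0..u} ?K\<bar>"
    using Q_eq_integral_kernel[OF \<phi> u] set_lebesgue_integral_eq_integral(2)[OF Ku] by simp
  also have "\<dots> \<le> integral {0..u} (\<lambda>v. \<bar>?K v\<bar>)"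
    using absolutely_integrable_on_def[where f = ?K] Ku integral_norm_bound_integral[of ?K "{0..u}" "\<lambda>v. \<bar>?K v\<bar>"]
    by auto
  also have "\<dots> \<le> integral {0..1} (\<lambda>v. \<bar>?K v\<bar>)"
    using absolutely_integrable_on_def[where f = ?K] K Ku u by (intro integral_subset_le) auto
  also have "\<dots> \<le> integral {0..1} (\<lambda>v. c / 2 + (?K v)\<^sup>2 / (2 * c))"
  proof (rule integral_le)
    show "(\<lambda>v. \<bar>?K v\<bar>) integrable_on {0..1}"
      using K absolutely_integrable_on_def[where f = ?K] by auto
    show "(\<lambda>v. c / 2 + (?K v)\<^sup>2 / (2 * c)) integrable_on {0..1}"
      using set_lebesgue_integral_eq_integral(1)[OF integral_kernel_squared(2)[OF \<phi>, of n t]]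
      by (intro integrable_add integrable_on_divide) auto
    show "\<bar>?K v\<bar> \<le> c / 2 + (?K v)\<^sup>2 / (2 * c)" for v
    proof -
      have "0 \<le> (\<bar>?K v\<bar> - c)\<^sup>2" by simp
      then have "2 * c * \<bar>?K v\<bar> \<le> c\<^sup>2 + (?K v)\<^sup>2"
        by (simp add: power2_diff mult_ac add.commute)
      then show ?thesis
        using c by (simp add: field_simps power2_eq_square)
    qed
  qed
  also have "\<dots> = c / 2 + integral {0..1} (\<lambda>v. (?K v)\<^sup>2) / (2 * c)"
    using set_lebesgue_integral_eq_integral(1)[OF integral_kernel_squared(2)[OF \<phi>, of n t]]
    by (subst integral_add) (auto intro: integrable_on_divide)
  also have "integral {0..1} (\<lambda>v. (?K v)\<^sup>2) = (\<Sum>k=1..n. (\<phi> k t)\<^sup>2)"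
    using integral_kernel_squared[OF \<phi>, of n t] set_lebesgue_integral_eq_integral(2) by metis
  also have "c / 2 + (\<Sum>k=1..n. (\<phi> k t)\<^sup>2) / (2 * c) \<le> c / 2 + c\<^sup>2 / (2 * c)"
    using c by (intro add_left_mono divide_right_mono) auto
  also have "\<dots> = c"
    using c by (simp add: power2_eq_square)
  finally show ?thesis .
qed

text \<open>
  The partial sum at \<open>t\<close> pairs the function with the kernel. Two integrations by parts move
  both antiderivatives from \<open>h\<close> onto the kernel, whose first antiderivative is \<open>Q\<close>.
\<close>
lemma fourier_sum_iterated_antiderivative:
  assumes \<phi>: "orthonormal_system \<phi>" and h: "continuous_on {0..1} h"
  shows "fourier_sum \<phi> n t (\<lambda>u. integral {u..1} (\<lambda>v. integral {v..1} h)) =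
    integral {0..1} (\<lambda>w. h w * integral {0..w} (\<lambda>u. Q \<phi> n u t))"
proof -
  define P where "P v = integral {v..1} h" for v
  have tail_cont: "continuous_on {0..1} (\<lambda>u. integral {u..1} f)"
    if "continuous_on {0..1} f" for f :: "real \<Rightarrow> real"
    by (intro indefinite_integral_continuous_1' integrable_continuous_real that)
  have P: "continuous_on {0..1} P"
    unfolding P_def by (rule tail_cont[OF h])
  have L: "(LINT v:{x..y}|lebesgue. f v) = integral {x..y} f"
    if "continuous_on {0..1} f" "x \<ge> 0" "y \<le> 1" for f :: "real \<Rightarrow> real" and x y
    using that by (intro set_lebesgue_integral_eq_integral(2) absolutely_integrable_continuous_real)
      (auto elim: continuous_on_subset)
  note Qc = continuous_on_Q[OF \<phi>, of n t]
  have "fourier_sum \<phi> n t (\<lambda>u. integral {u..1} P)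
      = (LINT u:{0..1}|lebesgue. integral {u..1} P * partial_sum_kernel \<phi> n t u)"
    by (rule fourier_sum_eq_integral_kernel[OF \<phi> tail_cont[OF P]])
  also have "\<dots> = (LINT u:{0..1}|lebesgue. (LINT v:{u..1}|lebesgue. P v) * partial_sum_kernel \<phi> n t u)"
    by (intro set_lebesgue_integral_cong) (auto simp: L[OF P])
  also have "\<dots> = (LINT v:{0..1}|lebesgue. P v * (LINT u:{0..v}|lebesgue. partial_sum_kernel \<phi> n t u))"
    by (intro integral_upper_tail_mult kernel_absolutely_integrable[OF \<phi>]
        absolutely_integrable_continuous_real P)
  also have "\<dots> = (LINT v:{0..1}|lebesgue. (LINT w:{v..1}|lebesgue. h w) * Q \<phi> n v t)"
    by (intro set_lebesgue_integral_cong) (auto simp: Q_eq_integral_kernel[OF \<phi>] P_def L[OF h])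
  also have "\<dots> = (LINT w:{0..1}|lebesgue. h w * (LINT v:{0..w}|lebesgue. Q \<phi> n v t))"
    by (intro integral_upper_tail_mult absolutely_integrable_continuous_real h Qc)
  also have "\<dots> = (LINT w:{0..1}|lebesgue. h w * integral {0..w} (\<lambda>v. Q \<phi> n v t))"
    by (intro set_lebesgue_integral_cong) (auto simp: L[OF Qc])
  also have "\<dots> = integral {0..1} (\<lambda>w. h w * integral {0..w} (\<lambda>v. Q \<phi> n v t))"
    by (intro L continuous_intros h indefinite_integral_continuous_1 integrable_continuous_real Qc) auto
  finally show ?thesis
    unfolding P_def .
qed

text \<open>
  \<open>M\<close> is a Riemann sum with step \<open>1/n\<close> for the \<open>L\<close>\<open>\<^sup>1\<close> norm of the antiderivative of \<open>Q\<close>. That antiderivative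
  has Lipschitz constant \<open>C * n\<close> because \<open>Q\<close> is bounded by \<open>C * n\<close>, so the Riemann sum exceeds the norm by
  at most \<open>C\<close>, uniformly in \<open>n\<close>. The growth rate \<open>n\<^sup>2\<close> in the definition of \<open>G\<close> is exactly what this needs.
\<close>
lemma M_le_L1_norm:
  assumes \<phi>: "orthonormal_system \<phi>" and n: "n > 0" and C: "C > 0"
    and bound: "(\<Sum>k=1..n. (\<phi> k t)\<^sup>2) \<le> (C * real n)\<^sup>2"
  shows "M \<phi> n t \<le> integral {0..1} (\<lambda>w. \<bar>integral {0..w} (\<lambda>u. Q \<phi> n u t)\<bar>) + C"
proof -
  define W where "W w = integral {0..w} (\<lambda>u. Q \<phi> n u t)" for w
  note Qc = continuous_on_Q[OF \<phi>, of n t]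
  have W: "(W has_real_derivative Q \<phi> n x t) (at x within {0..1})" if "x \<in> {0..1}" for x
    unfolding W_def using integral_has_real_derivative[OF Qc that] .
  have lip: "(C * n)-lipschitz_on {0..1} W"
  proof (rule lipschitz_onI)
    show "dist (W x) (W y) \<le> C * n * dist x y" if "x \<in> {0..1}" "y \<in> {0..1}" for x y
      using field_differentiable_bound[of "{0..1}" W "\<lambda>u. Q \<phi> n u t" "C * n" x y] that
        W abs_Q_le[OF \<phi> _ bound] C n
      by (simp add: dist_norm norm_minus_commute)
  qed (use C in simp)
  have "(C * n)-lipschitz_on {0..1} (\<lambda>w. \<bar>W w\<bar>)"
  proof (rule lipschitz_onI)
    show "dist \<bar>W x\<bar> \<bar>W y\<bar> \<le> C * n * dist x y" if "x \<in> {0..1}" "y \<in> {0..1}" for x y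
      using lipschitz_onD(1)[OF lip that] by (simp add: dist_real_def)
  qed (use C in simp)
  from riemann_sum_le_integral[OF this _ n]
  have "1 / n * (\<Sum>i=1..<n. \<bar>W (real i / real n)\<bar>) \<le> integral {0..1} (\<lambda>w. \<bar>W w\<bar>) + C"
    using n by simp
  moreover have "(LINT u:{0..real i / real n}|lebesgue. Q \<phi> n u t) = W (real i / real n)" if "i \<in> {1..<n}" for i
    unfolding W_def using that
    by (intro set_lebesgue_integral_eq_integral(2) absolutely_integrable_continuous_real
        continuous_on_subset[OF Qc]) (auto simp: field_simps)
  ultimately show ?thesis
    by (simp add: M_def W_def)
qed

section \<open>Divergence for a function in the class\<close>
theorem theorem2:
  fixes \<phi> :: "nat \<Rightarrow> real \<Rightarrow> real" and t :: real
  assumes "orthonormal_system \<phi>"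
    and "t \<in> G \<phi>"
    and "limsup (\<lambda>n. ereal (M \<phi> n t)) = \<infinity>"
  shows "\<exists>r\<in>C_L. limsup (\<lambda>n. ereal \<bar>fourier_sum \<phi> n t r\<bar>) = \<infinity>"
proof (rule ccontr)
  assume neg: "\<not> ?thesis"
  note \<phi> = assms(1)
  define W where "W n w = integral {0..w} (\<lambda>u. Q \<phi> n u t)" for n w
  have "\<exists>B. \<forall>n. integral {0..1} (\<lambda>w. \<bar>W n w\<bar>) \<le> B"
  proof (rule L1_bounded_if_weakly_bounded)
    show "continuous_on {0..1} (W n)" for n
      unfolding W_def
      by (intro indefinite_integral_continuous_1 integrable_continuous_real continuous_on_Q[OF \<phi>])
    fix h :: "real \<Rightarrow> real" assume h: "continuous_on {0..1} h"
    let ?r = "\<lambda>u. integral {u..1} (\<lambda>v. integral {v..1} h)"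
    have "bdd_above (range (\<lambda>n. \<bar>fourier_sum \<phi> n t ?r\<bar>))"
      using neg iterated_antiderivative_in_C_L[OF h] by (auto simp: limsup_ereal_eq_infinity_iff)
    then show "\<exists>B. \<forall>n. \<bar>integral {0..1} (\<lambda>w. h w * W n w)\<bar> \<le> B"
      by (simp add: fourier_sum_iterated_antiderivative[OF \<phi> h] W_def bdd_above_def)
  qed
  then obtain B where B: "\<And>n. integral {0..1} (\<lambda>w. \<bar>W n w\<bar>) \<le> B" by blast
  have "bdd_above (range (\<lambda>n. 1 / (real n)\<^sup>2 * (\<Sum>k=1..n. (\<phi> k t)\<^sup>2)))"
    using assms(2) limsup_ereal_eq_infinity_iff by (auto simp: G_def F_def)
  then obtain K where K: "\<And>n. 1 / (real n)\<^sup>2 * (\<Sum>k=1..n. (\<phi> k t)\<^sup>2) \<le> K"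
    by (auto simp: bdd_above_def)
  \<comment> \<open>at least \<open>1\<close>, so that \<open>K \<le> C \<le> C\<^sup>2\<close>\<close>
  define C where "C = \<bar>K\<bar> + 1"
  have "C > 0"
    by (simp add: C_def)
  have "C * 1 \<le> C * C"
    by (intro mult_left_mono) (auto simp: C_def)
  then have "K \<le> C\<^sup>2"
    by (simp add: C_def power2_eq_square)
  have C: "(\<Sum>k=1..n. (\<phi> k t)\<^sup>2) \<le> (C * real n)\<^sup>2" if "n > 0" for n
  proof -
    have "1 / (real n)\<^sup>2 * (\<Sum>k=1..n. (\<phi> k t)\<^sup>2) \<le> C\<^sup>2"
      using K[of n] \<open>K \<le> C\<^sup>2\<close> by linarith
    then show ?thesis
      using that by (simp add: field_simps power_mult_distrib)
  qed
  have "M \<phi> n t \<le> max 0 (B + C)" for n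
  proof (cases "n = 0")
    case False
    then show ?thesis
      using M_le_L1_norm[OF \<phi> _ \<open>C > 0\<close> C, of n] B[of n] by (simp add: W_def)
  qed (simp add: M_def)
  then have "bdd_above (range (\<lambda>n. M \<phi> n t))"
    by (auto simp: bdd_above_def)
  with assms(3) show False
    by (simp add: limsup_ereal_eq_infinity_iff)
qed

end
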